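(* Let $G$ be a finite abelian group with $|G|>1$ that is not an elementary abelian $2$-group. Let $\alpha=\theta_{xy}$, $\beta\in\{\theta_{xy},\theta_{x^{-1}y}\}$, $\gamma=\theta_{xy}$, $\delta\in\{\theta_{xy},\theta_{x^{-1}y},\theta_{xy^{-1}},\theta_{x^{-1}y^{-1}}\}$, and let $(M,* )=G(\alpha,\beta,\gamma,\delta)$. (1) $(M,* )$ is a group if and only if it is one of (a) $G(\theta_{xy},\theta_{xy},\theta_{xy},\theta_{xy})$, (b) $G(\theta_{xy},\theta_{x^{-1}y},\theta_{xy},\theta_{x^{-1}y})$. The group (a) is the direct product $G\times C_2$, and the group (b) is isomorphic to the Chein loop $M(G,2)$. (2) The following three conditions are equivalent: (i) $(M,* )$ is a nonassociative left Bol loop; (ii) $(M,* )$ is a left Bol loop that is not Moufang; (iii) $g^4=1$ for every $g\in G$ and $(M,* )$ is one of (c) $G(\theta_{xy},\theta_{xy},\theta_{xy},\theta_{x^{-1}y})$, (d) $G(\theta_{xy},\theta_{x^{-1}y},\theta_{xy},\theta_{xy})$. (3) For a given $G$, the two loops (c) and (d) are not isomorphic.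
   Context: For a group $G$ and a word $uv$ among $xy$, $xy^{-1}$, $x^{-1}y$, $x^{-1}y^{-1}$, $yx$, $yx^{-1}$, $y^{-1}x$, $y^{-1}x^{-1}$, the symbol $\theta_{uv}$ denotes the multiplication $G\times G\to G$ sending $(a,b)$ to the value in $G$ of the word $uv$ at $x=a$, $y=b$ (e.g. $\theta_{y^{-1}x}(a,b)=b^{-1}a$). Let $\overline{G}=\{\overline g : g\in G\}$ be a disjoint copy of $G$. For four such multiplications $\alpha,\beta,\gamma,\delta$, $G(\alpha,\beta,\gamma,\delta)$ denotes the set $G\cup\overline{G}$ with the operation, for $g,h\in G$, $$g*h=\alpha(g,h),\quad g*\overline{h}=\overline{\beta(g,h)},\quad \overline{g}*h=\overline{\gamma(g,h)},\quad \overline{g}*\overline{h}=\delta(g,h).$$ It is a quasigroup. The Chein loop is $M(G,2)=G(\theta_{xy},\theta_{yx},\theta_{xy^{-1}},\theta_{y^{-1}x})$. A loop is left Bol if it satisfies $x(y(xz))=(x(yx))z$; it is Moufang if it satisfies $x(y(xz))=((xy)x)z$ (equivalently, it is both left and right Bol). $C_2$ is the cyclic group of order $2$. When $G$ is abelian, each of the eight multiplications coincides with one of $\theta_{xy},\theta_{x^{-1}y},\theta_{xy^{-1}},\theta_{x^{-1}y^{-1}}$. *)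

theory Defs
  imports "HOL-Algebra.Algebra"
begin

(* The words uv; a capital letter stands for an inverse, e.g. W_Yx is y^{-1}x. *)
datatype mult_word = W_xy | W_xY | W_Xy | W_XY | W_yx | W_yX | W_Yx | W_YX

fun theta :: "('a, 'm) monoid_scheme \<Rightarrow> mult_word \<Rightarrow> 'a \<Rightarrow> 'a \<Rightarrow> 'a" where
  "theta G W_xy a b = a \<otimes>\<^bsub>G\<^esub> b"
| "theta G W_xY a b = a \<otimes>\<^bsub>G\<^esub> inv\<^bsub>G\<^esub> b"
| "theta G W_Xy a b = inv\<^bsub>G\<^esub> a \<otimes>\<^bsub>G\<^esub> b"
| "theta G W_XY a b = inv\<^bsub>G\<^esub> a \<otimes>\<^bsub>G\<^esub> inv\<^bsub>G\<^esub> b"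
| "theta G W_yx a b = b \<otimes>\<^bsub>G\<^esub> a"
| "theta G W_yX a b = b \<otimes>\<^bsub>G\<^esub> inv\<^bsub>G\<^esub> a"
| "theta G W_Yx a b = inv\<^bsub>G\<^esub> b \<otimes>\<^bsub>G\<^esub> a"
| "theta G W_YX a b = inv\<^bsub>G\<^esub> b \<otimes>\<^bsub>G\<^esub> inv\<^bsub>G\<^esub> a"

(* The disjoint union of G with its copy: Inl g is g and Inr g is the barred g. *)
fun doubling_mult ::
  "('a \<Rightarrow> 'a \<Rightarrow> 'a) \<Rightarrow> ('a \<Rightarrow> 'a \<Rightarrow> 'a) \<Rightarrow> ('a \<Rightarrow> 'a \<Rightarrow> 'a) \<Rightarrow> ('a \<Rightarrow> 'a \<Rightarrow> 'a)
    \<Rightarrow> 'a + 'a \<Rightarrow> 'a + 'a \<Rightarrow> 'a + 'a" where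
  "doubling_mult \<alpha> \<beta> \<gamma> \<delta> (Inl g) (Inl h) = Inl (\<alpha> g h)"
| "doubling_mult \<alpha> \<beta> \<gamma> \<delta> (Inl g) (Inr h) = Inr (\<beta> g h)"
| "doubling_mult \<alpha> \<beta> \<gamma> \<delta> (Inr g) (Inl h) = Inr (\<gamma> g h)"
| "doubling_mult \<alpha> \<beta> \<gamma> \<delta> (Inr g) (Inr h) = Inl (\<delta> g h)"

definition is_identity :: "'a set \<Rightarrow> ('a \<Rightarrow> 'a \<Rightarrow> 'a) \<Rightarrow> 'a \<Rightarrow> bool" where
  "is_identity S f e \<longleftrightarrow> e \<in> S \<and> (\<forall>x\<in>S. f e x = x \<and> f x e = x)"

(* G(alpha, beta, gamma, delta) is given by its carrier and operation only. The record type of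
   HOL-Algebra also asks for a unit: it is the identity element of the operation, which is unique
   when it exists (and unspecified otherwise). *)
definition doubling ::
  "('a, 'm) monoid_scheme \<Rightarrow> ('a \<Rightarrow> 'a \<Rightarrow> 'a) \<Rightarrow> ('a \<Rightarrow> 'a \<Rightarrow> 'a) \<Rightarrow> ('a \<Rightarrow> 'a \<Rightarrow> 'a)
    \<Rightarrow> ('a \<Rightarrow> 'a \<Rightarrow> 'a) \<Rightarrow> ('a + 'a) monoid" where
  "doubling G \<alpha> \<beta> \<gamma> \<delta> =
     \<lparr>carrier = carrier G <+> carrier G,
      monoid.mult = doubling_mult \<alpha> \<beta> \<gamma> \<delta>,
      one = (THE e. is_identity (carrier G <+> carrier G) (doubling_mult \<alpha> \<beta> \<gamma> \<delta>) e)\<rparr>"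

definition chein_loop :: "('a, 'm) monoid_scheme \<Rightarrow> ('a + 'a) monoid" where
  "chein_loop G = doubling G (theta G W_xy) (theta G W_yx) (theta G W_xY) (theta G W_Yx)"

definition quasigroup :: "('a, 'm) monoid_scheme \<Rightarrow> bool" where
  "quasigroup L \<longleftrightarrow>
     (\<forall>x\<in>carrier L. \<forall>y\<in>carrier L. x \<otimes>\<^bsub>L\<^esub> y \<in> carrier L) \<and>
     (\<forall>a\<in>carrier L. \<forall>b\<in>carrier L.
        (\<exists>!x. x \<in> carrier L \<and> a \<otimes>\<^bsub>L\<^esub> x = b) \<and> (\<exists>!y. y \<in> carrier L \<and> y \<otimes>\<^bsub>L\<^esub> a = b))"

definition loop :: "('a, 'm) monoid_scheme \<Rightarrow> bool" where
  "loop L \<longleftrightarrow> quasigroup L \<and> is_identity (carrier L) (monoid.mult L) \<one>\<^bsub>L\<^esub>"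

definition left_bol_loop :: "('a, 'm) monoid_scheme \<Rightarrow> bool" where
  "left_bol_loop L \<longleftrightarrow> loop L \<and>
     (\<forall>x\<in>carrier L. \<forall>y\<in>carrier L. \<forall>z\<in>carrier L.
        x \<otimes>\<^bsub>L\<^esub> (y \<otimes>\<^bsub>L\<^esub> (x \<otimes>\<^bsub>L\<^esub> z)) = (x \<otimes>\<^bsub>L\<^esub> (y \<otimes>\<^bsub>L\<^esub> x)) \<otimes>\<^bsub>L\<^esub> z)"

definition moufang_loop :: "('a, 'm) monoid_scheme \<Rightarrow> bool" where
  "moufang_loop L \<longleftrightarrow> loop L \<and>
     (\<forall>x\<in>carrier L. \<forall>y\<in>carrier L. \<forall>z\<in>carrier L.
        x \<otimes>\<^bsub>L\<^esub> (y \<otimes>\<^bsub>L\<^esub> (x \<otimes>\<^bsub>L\<^esub> z)) = ((x \<otimes>\<^bsub>L\<^esub> y) \<otimes>\<^bsub>L\<^esub> x) \<otimes>\<^bsub>L\<^esub> z)"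

definition associative :: "('a, 'm) monoid_scheme \<Rightarrow> bool" where
  "associative L \<longleftrightarrow>
     (\<forall>x\<in>carrier L. \<forall>y\<in>carrier L. \<forall>z\<in>carrier L.
        (x \<otimes>\<^bsub>L\<^esub> y) \<otimes>\<^bsub>L\<^esub> z = x \<otimes>\<^bsub>L\<^esub> (y \<otimes>\<^bsub>L\<^esub> z))"

definition elementary_abelian_2_group :: "('a, 'm) monoid_scheme \<Rightarrow> bool" where
  "elementary_abelian_2_group G \<longleftrightarrow>
     comm_group G \<and> (\<forall>g\<in>carrier G. g [^]\<^bsub>G\<^esub> (2::nat) = \<one>\<^bsub>G\<^esub>)"

end

theory Submission
  imports Defs
begin

text \<open>
  Evaluating the left Bol law on the eight sign patterns of \<open>x\<close>, \<open>y\<close>, \<open>z\<close> in \<open>G\<close> or its copy leaves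
  identities in an abelian group. For \<open>\<delta> = \<theta>\<^bsub>xy\<^sup>-\<^sup>1\<^esub>\<close> and \<open>\<delta> = \<theta>\<^bsub>x\<^sup>-\<^sup>1y\<^sup>-\<^sup>1\<^esub>\<close> one of them is \<open>g = g\<^sup>-\<^sup>1\<close>, which fails
  in a group that is not an elementary abelian 2-group; for (c) and (d) they all reduce to \<open>g\<^sup>4 = 1\<close>, and
  the Moufang law would again give \<open>g = g\<^sup>-\<^sup>1\<close>. The loops (c) and (d) are told apart by the number of
  solutions of \<open>x * x = 1\<close>: if \<open>t < |G|\<close> elements of \<open>G\<close> satisfy \<open>g\<^sup>2 = 1\<close>, it is \<open>t + |G|\<close> in (c), where
  every element of the copy squares to 1, and \<open>2t\<close> in (d).
\<close>

section \<open>Doublings of quasigroup operations\<close>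

text \<open>The record predicate \<open>quasigroup\<close> restated for a bare operation, since the
  four blocks of a doubling share one carrier.\<close>

definition quasigroup_op :: "'a set \<Rightarrow> ('a \<Rightarrow> 'a \<Rightarrow> 'a) \<Rightarrow> bool" where
  "quasigroup_op S f \<longleftrightarrow>
     (\<forall>x\<in>S. \<forall>y\<in>S. f x y \<in> S) \<and>
     (\<forall>a\<in>S. \<forall>b\<in>S. (\<exists>!x. x \<in> S \<and> f a x = b) \<and> (\<exists>!y. y \<in> S \<and> f y a = b))"

text \<open>In a doubling, the coefficients of an equation decide in which summand its solution
  lies, so solving it reduces to one block.\<close>

lemma ex1_Plus_Inl:
  "(\<And>y. \<not> P (Inr y)) \<Longrightarrow> (\<exists>!x. x \<in> A <+> B \<and> P x) \<longleftrightarrow> (\<exists>!x. x \<in> A \<and> P (Inl x))"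
  by (auto simp: Ex1_def split_sum_all)

lemma ex1_Plus_Inr:
  "(\<And>y. \<not> P (Inl y)) \<Longrightarrow> (\<exists>!x. x \<in> A <+> B \<and> P x) \<longleftrightarrow> (\<exists>!x. x \<in> B \<and> P (Inr x))"
  by (auto simp: Ex1_def split_sum_all)

lemma carrier_doubling [simp]: "carrier (doubling G \<alpha> \<beta> \<gamma> \<delta>) = carrier G <+> carrier G"
  and mult_doubling [simp]: "monoid.mult (doubling G \<alpha> \<beta> \<gamma> \<delta>) = doubling_mult \<alpha> \<beta> \<gamma> \<delta>"
  by (simp_all add: doubling_def)

lemma ball_Plus: "(\<forall>x\<in>A <+> B. P x) \<longleftrightarrow> (\<forall>a\<in>A. P (Inl a)) \<and> (\<forall>b\<in>B. P (Inr b))"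
  by auto

lemma quasigroup_doubling:
  assumes "quasigroup_op (carrier G) \<alpha>" "quasigroup_op (carrier G) \<beta>"
    "quasigroup_op (carrier G) \<gamma>" "quasigroup_op (carrier G) \<delta>"
  shows "quasigroup (doubling G \<alpha> \<beta> \<gamma> \<delta>)"
  unfolding quasigroup_def carrier_doubling mult_doubling ball_Plus
  using assms
  by (simp add: quasigroup_op_def ex1_Plus_Inl ex1_Plus_Inr InlI InrI)

abbreviation word_doubling ::
  "('a, 'm) monoid_scheme \<Rightarrow> mult_word \<Rightarrow> mult_word \<Rightarrow> mult_word \<Rightarrow> mult_word \<Rightarrow> ('a + 'a) monoid" where
  "word_doubling G u v w t \<equiv> doubling G (theta G u) (theta G v) (theta G w) (theta G t)"

section \<open>Loops, associativity and the Bol and Moufang laws\<close>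

lemma is_identity_unique: "is_identity S f e \<Longrightarrow> is_identity S f e' \<Longrightarrow> e = e'"
  by (metis is_identity_def)

lemma left_bolD:
  "left_bol_loop L \<Longrightarrow> x \<in> carrier L \<Longrightarrow> y \<in> carrier L \<Longrightarrow> z \<in> carrier L \<Longrightarrow>
    x \<otimes>\<^bsub>L\<^esub> (y \<otimes>\<^bsub>L\<^esub> (x \<otimes>\<^bsub>L\<^esub> z)) = (x \<otimes>\<^bsub>L\<^esub> (y \<otimes>\<^bsub>L\<^esub> x)) \<otimes>\<^bsub>L\<^esub> z"
  by (simp add: left_bol_loop_def)

lemma moufangD:
  "moufang_loop L \<Longrightarrow> x \<in> carrier L \<Longrightarrow> y \<in> carrier L \<Longrightarrow> z \<in> carrier L \<Longrightarrow>
    x \<otimes>\<^bsub>L\<^esub> (y \<otimes>\<^bsub>L\<^esub> (x \<otimes>\<^bsub>L\<^esub> z)) = ((x \<otimes>\<^bsub>L\<^esub> y) \<otimes>\<^bsub>L\<^esub> x) \<otimes>\<^bsub>L\<^esub> z"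
  by (simp add: moufang_loop_def)

lemma group_imp_associative: "group L \<Longrightarrow> associative L"
  by (simp add: associative_def monoid.m_assoc group.is_monoid)

lemma associative_loop_imp_group:
  assumes "loop L" "associative L"
  shows "group L"
proof (rule groupI)
  show "\<exists>y\<in>carrier L. y \<otimes>\<^bsub>L\<^esub> x = \<one>\<^bsub>L\<^esub>" if "x \<in> carrier L" for x
    using that assms(1) unfolding loop_def quasigroup_def is_identity_def by blast
qed (use assms in \<open>auto simp: loop_def quasigroup_def is_identity_def associative_def\<close>)

lemma associative_imp_left_bol: "loop L \<Longrightarrow> associative L \<Longrightarrow> left_bol_loop L"
  by (auto simp: left_bol_loop_def associative_def loop_def quasigroup_def)

lemma associative_imp_moufang: "loop L \<Longrightarrow> associative L \<Longrightarrow> moufang_loop L"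
  by (auto simp: moufang_loop_def associative_def loop_def quasigroup_def)

section \<open>The eight words as quasigroup operations\<close>

context group
begin

lemma ex1_mult_right: "a \<in> carrier G \<Longrightarrow> b \<in> carrier G \<Longrightarrow> \<exists>!x. x \<in> carrier G \<and> a \<otimes> x = b"
  by (rule ex1I[of _ "inv a \<otimes> b"]) (auto simp: inv_solve_left m_assoc[symmetric])

lemma ex1_mult_left: "a \<in> carrier G \<Longrightarrow> b \<in> carrier G \<Longrightarrow> \<exists>!x. x \<in> carrier G \<and> x \<otimes> a = b"
  by (rule ex1I[of _ "b \<otimes> inv a"]) (auto simp: m_assoc)

text \<open>Inversion permutes the carrier. Hence the words with inverted letters inherit unique
  solvability from plain multiplication.\<close>

lemma ex1_inv:
  assumes "\<exists>!x. x \<in> carrier G \<and> P x"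
  shows "\<exists>!x. x \<in> carrier G \<and> P (inv x)"
  using assms by (metis inv_closed inv_inv)

lemma theta_closed [simp]: "a \<in> carrier G \<Longrightarrow> b \<in> carrier G \<Longrightarrow> theta G w a b \<in> carrier G"
  by (cases w) auto

lemma quasigroup_op_theta: "quasigroup_op (carrier G) (theta G w)"
  unfolding quasigroup_op_def
  by (cases w)
    (auto intro!: ex1_mult_left ex1_mult_right
      ex1_inv[of "\<lambda>x. _ \<otimes> x = _"] ex1_inv[of "\<lambda>x. x \<otimes> _ = _"] simp del: theta_closed)

end

section \<open>Computation in abelian groups and the loops with unit
  \<open>Inl \<one>\<close>\<close>

context comm_group
begin

lemma l_inv_cancel: "x \<in> carrier G \<Longrightarrow> y \<in> carrier G \<Longrightarrow> inv x \<otimes> (x \<otimes> y) = y"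
  and r_inv_cancel: "x \<in> carrier G \<Longrightarrow> y \<in> carrier G \<Longrightarrow> x \<otimes> (inv x \<otimes> y) = y"
  by (simp_all flip: m_assoc)

lemma l_inv_cancel_mid: "x \<in> carrier G \<Longrightarrow> y \<in> carrier G \<Longrightarrow> z \<in> carrier G \<Longrightarrow> inv x \<otimes> (y \<otimes> (x \<otimes> z)) = y \<otimes> z"
  and r_inv_cancel_mid: "x \<in> carrier G \<Longrightarrow> y \<in> carrier G \<Longrightarrow> z \<in> carrier G \<Longrightarrow> x \<otimes> (y \<otimes> (inv x \<otimes> z)) = y \<otimes> z"
  by (simp_all add: m_lcomm[of _ y] l_inv_cancel r_inv_cancel)

lemma l_inv_cancel_end: "x \<in> carrier G \<Longrightarrow> y \<in> carrier G \<Longrightarrow> inv x \<otimes> (y \<otimes> x) = y"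
  and r_inv_cancel_end: "x \<in> carrier G \<Longrightarrow> y \<in> carrier G \<Longrightarrow> x \<otimes> (y \<otimes> inv x) = y"
  by (simp_all add: m_lcomm[of _ y])

lemma l_inv_cancel_end2:
    "x \<in> carrier G \<Longrightarrow> y \<in> carrier G \<Longrightarrow> z \<in> carrier G \<Longrightarrow> inv x \<otimes> (y \<otimes> (z \<otimes> x)) = y \<otimes> z"
  and r_inv_cancel_end2:
    "x \<in> carrier G \<Longrightarrow> y \<in> carrier G \<Longrightarrow> z \<in> carrier G \<Longrightarrow> x \<otimes> (y \<otimes> (z \<otimes> inv x)) = y \<otimes> z"
  by (metis l_inv_cancel_end m_assoc m_closed inv_closed) (metis r_inv_cancel_end m_assoc m_closed inv_closed)

text \<open>Ordered rewriting need not put a factor next to its inverse, so the cancellation laws have to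
  reach across other factors.\<close>

lemmas abelian_simps = m_assoc m_comm m_lcomm inv_mult l_inv_cancel r_inv_cancel
  l_inv_cancel_mid r_inv_cancel_mid l_inv_cancel_end r_inv_cancel_end l_inv_cancel_end2 r_inv_cancel_end2

lemma is_identity_word_doubling:
  assumes "v \<in> {W_xy, W_Xy}"
  shows "is_identity (carrier (word_doubling G W_xy v W_xy t))
    (monoid.mult (word_doubling G W_xy v W_xy t)) (Inl \<one>)"
  using assms by (auto simp: is_identity_def)

text \<open>The unit field of a doubling is a definite description, so its value needs both
  existence and uniqueness of the identity.\<close>

lemma one_word_doubling:
  assumes "v \<in> {W_xy, W_Xy}"
  shows "\<one>\<^bsub>word_doubling G W_xy v W_xy t\<^esub> = Inl \<one>" (is "\<one>\<^bsub>?M\<^esub> = _")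
proof -
  have "(THE e. is_identity (carrier ?M) (monoid.mult ?M) e) = Inl \<one>"
    using is_identity_word_doubling[OF assms, of t]
    by (rule the_equality) (rule is_identity_unique[OF _ is_identity_word_doubling[OF assms, of t]])
  then show ?thesis by (simp add: doubling_def)
qed

lemma loop_word_doubling:
  assumes "v \<in> {W_xy, W_Xy}"
  shows "loop (word_doubling G W_xy v W_xy t)"
  unfolding loop_def one_word_doubling[OF assms]
  using is_identity_word_doubling[OF assms]
  by (simp add: quasigroup_doubling quasigroup_op_theta)

lemma group_word_doubling:
  assumes "v \<in> {W_xy, W_Xy}"
  shows "group (word_doubling G W_xy v W_xy v)"
proof (rule associative_loop_imp_group)
  show "associative (word_doubling G W_xy v W_xy v)"
    using assms unfolding associative_def carrier_doubling mult_doubling ball_Plus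
    by (auto simp: abelian_simps)
qed (rule loop_word_doubling[OF assms])

section \<open>The two groups identified\<close>

lemma xy_xy_xy_xy_iso_DirProd: "word_doubling G W_xy W_xy W_xy W_xy \<cong> G \<times>\<times> integer_mod_group 2"
proof -
  let ?f = "case_sum (\<lambda>g. (g, 0)) (\<lambda>g. (g, 1::int))"
  have "bij_betw ?f (Sum_Type.Plus (carrier G) (carrier G)) (carrier G \<times> {0..<2})"
    by (rule bij_betw_byWitness[where f' = "\<lambda>(g, i). if i = 0 then Inl g else Inr g"]) auto
  then show ?thesis
    by (intro is_isoI[of ?f] isoI homI) (auto simp: carrier_integer_mod_group integer_mod_group_def)
qed

lemma xy_Xy_xy_Xy_iso_chein_loop: "word_doubling G W_xy W_Xy W_xy W_Xy \<cong> chein_loop G"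
proof -
  \<comment> \<open>Inverting only the copy turns the blocks of (b) into those of the Chein loop.
    The map is an involution, hence its own inverse witness below.\<close>
  let ?f = "map_sum (\<lambda>g. g) (\<lambda>g. inv g)"
  have "bij_betw ?f (Sum_Type.Plus (carrier G) (carrier G)) (Sum_Type.Plus (carrier G) (carrier G))"
    by (rule bij_betw_byWitness[where f' = ?f]) auto
  then show ?thesis
    unfolding chein_loop_def
    by (intro is_isoI[of ?f] isoI homI) (auto simp: abelian_simps)
qed

section \<open>The left Bol and Moufang laws\<close>

lemma inv_mult_self_eq_iff: "g \<in> carrier G \<Longrightarrow> inv g \<otimes> inv g = g \<otimes> g \<longleftrightarrow> g [^] (4::nat) = \<one>"
proof -
  assume g: "g \<in> carrier G"
  have "g [^] (4::nat) = (g \<otimes> g) \<otimes> (g \<otimes> g)"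
    using g by (simp add: numeral_eq_Suc m_assoc)
  then show ?thesis
    using g by (metis inv_equality inv_mult m_closed r_inv)
qed

lemma left_bol_xy_xy_xy_Xy_iff:
  "left_bol_loop (word_doubling G W_xy W_xy W_xy W_Xy) \<longleftrightarrow>
   (\<forall>g\<in>carrier G. g [^] (4::nat) = \<one>)" (is "left_bol_loop ?M \<longleftrightarrow> ?R")
proof
  assume *: "left_bol_loop ?M"
  have "inv g \<otimes> inv g = g \<otimes> g" if "g \<in> carrier G" for g
    \<comment> \<open>The left side evaluates to \<open>g \<otimes> g\<close>, the right side to its
      inverse.\<close>
    using left_bolD[OF *, of "Inl g" "Inr \<one>" "Inr \<one>"] that by (simp add: InlI InrI inv_mult)
  then show ?R by (simp add: inv_mult_self_eq_iff)
next
  assume ?R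
  then have inv_sq: "inv g \<otimes> inv g = g \<otimes> g" if "g \<in> carrier G" for g
    using that by (simp add: inv_mult_self_eq_iff)
  \<comment> \<open>Right-associated normal forms hide a square that has a factor behind it, so
    \<open>inv_sq\<close> is also needed in this shape.\<close>
  have inv_sq_mult: "inv g \<otimes> (inv g \<otimes> h) = g \<otimes> (g \<otimes> h)" if "g \<in> carrier G" "h \<in> carrier G" for g h
    using that inv_sq by (simp flip: m_assoc)
  show "left_bol_loop ?M"
    unfolding left_bol_loop_def carrier_doubling mult_doubling ball_Plus
    by (simp add: loop_word_doubling abelian_simps inv_sq inv_sq_mult)
qed

lemma left_bol_xy_Xy_xy_xy_iff:
  "left_bol_loop (word_doubling G W_xy W_Xy W_xy W_xy) \<longleftrightarrow>
   (\<forall>g\<in>carrier G. g [^] (4::nat) = \<one>)" (is "left_bol_loop ?M \<longleftrightarrow> ?R")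
proof
  assume *: "left_bol_loop ?M"
  have "inv g \<otimes> inv g = g \<otimes> g" if "g \<in> carrier G" for g
    \<comment> \<open>Here the two sides are the copies of \<open>g \<otimes> g\<close> and of its
      inverse.\<close>
    using left_bolD[OF *, of "Inr g" "Inl \<one>" "Inr \<one>"] that by (simp add: InlI InrI inv_mult)
  then show ?R by (simp add: inv_mult_self_eq_iff)
next
  assume ?R
  then have inv_sq: "inv g \<otimes> inv g = g \<otimes> g" if "g \<in> carrier G" for g
    using that by (simp add: inv_mult_self_eq_iff)
  have inv_sq_mult: "inv g \<otimes> (inv g \<otimes> h) = g \<otimes> (g \<otimes> h)" if "g \<in> carrier G" "h \<in> carrier G" for g h
    using that inv_sq by (simp flip: m_assoc)
  show "left_bol_loop ?M"
    unfolding left_bol_loop_def carrier_doubling mult_doubling ball_Plus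
    by (simp add: loop_word_doubling abelian_simps inv_sq inv_sq_mult)
qed

lemma not_left_bol_word_doubling:
  assumes "g \<in> carrier G" "g \<otimes> g \<noteq> \<one>"
    and vt: "v \<in> {W_xy, W_Xy}" "t \<in> {W_xY, W_XY}"
  shows "\<not> left_bol_loop (word_doubling G W_xy v W_xy t)"
proof
  assume "left_bol_loop (word_doubling G W_xy v W_xy t)"
  \<comment> \<open>In this instance no element of \<open>G\<close> multiplies the copy from the
    left, so \<open>v\<close> never enters; the sides are \<open>inv g\<close> and \<open>g\<close>
    for both values of \<open>t\<close>.\<close>
  from left_bolD[OF this, of "Inr \<one>" "Inr g" "Inr \<one>"] have "inv g = g"
    using assms(1) vt by (auto simp: InlI InrI)
  then show False using assms(1,2) by (metis r_inv)
qed

lemma not_moufang_xy_xy_xy_Xy: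
  assumes "g \<in> carrier G" "g \<otimes> g \<noteq> \<one>"
  shows "\<not> moufang_loop (word_doubling G W_xy W_xy W_xy W_Xy)"
proof
  assume "moufang_loop (word_doubling G W_xy W_xy W_xy W_Xy)"
  \<comment> \<open>The two laws part here: x(yx) is \<open>g\<close>, but (xy)x is
    \<open>inv g\<close>.\<close>
  from moufangD[OF this, of "Inr \<one>" "Inl g" "Inr \<one>"] have "inv g = g"
    using assms by (simp add: InlI InrI)
  then show False using assms by (metis r_inv)
qed

lemma not_moufang_xy_Xy_xy_xy:
  assumes "g \<in> carrier G" "g \<otimes> g \<noteq> \<one>"
  shows "\<not> moufang_loop (word_doubling G W_xy W_Xy W_xy W_xy)"
proof
  assume "moufang_loop (word_doubling G W_xy W_Xy W_xy W_xy)"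
  \<comment> \<open>Now x(yx) is \<open>inv g\<close>, while (xy)x is \<open>g\<close>.\<close>
  from moufangD[OF this, of "Inr \<one>" "Inl g" "Inl \<one>"] have "inv g = g"
    using assms by (simp add: InlI InrI)
  then show False using assms by (metis r_inv)
qed

section \<open>Telling (c) and (d) apart\<close>

lemma xy_xy_xy_Xy_not_iso_xy_Xy_xy_xy:
  assumes fin: "finite (carrier G)" and "\<exists>g\<in>carrier G. g \<otimes> g \<noteq> \<one>"
  shows "\<not> word_doubling G W_xy W_xy W_xy W_Xy \<cong>
    word_doubling G W_xy W_Xy W_xy W_xy" (is "\<not> ?C \<cong> ?D")
proof
  define T where "T = {g \<in> carrier G. g \<otimes> g = \<one>}"
  have "T \<subset> carrier G" using assms(2) by (auto simp: T_def)
  with fin have T: "card T < card (carrier G)" "finite T"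
    by (auto simp: psubset_card_mono finite_subset)
  assume "?C \<cong> ?D"
  then obtain f where hom: "f \<in> hom ?C ?D" and bij: "bij_betw f (carrier ?C) (carrier ?D)"
    by (auto simp: is_iso_def iso_def)
  \<comment> \<open>A \<open>hom\<close> preserves products only, so the unit is recognized as the
    sole idempotent: squares lie in \<open>G\<close>, and there only \<open>\<one>\<close> is its
    own square.\<close>
  have idem: "x = Inl \<one>" if "x \<in> carrier ?D" "x \<otimes>\<^bsub>?D\<^esub> x = x" for x
    using that by auto
  have f1: "f (Inl \<one>) = Inl \<one>"
    using hom_mult[OF hom, of "Inl \<one>" "Inl \<one>"] hom_in_carrier[OF hom, of "Inl \<one>"]
    by (intro idem) (simp_all add: InlI)
  \<comment> \<open>The solutions of x * x = 1 in (c) are sent to those in (d); injectivity of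
    \<open>f\<close> then contradicts the count.\<close>
  have "f ` (T <+> carrier G) \<subseteq> T <+> T"
  proof
    fix y assume "y \<in> f ` (T <+> carrier G)"
    then obtain x where x: "x \<in> T <+> carrier G" and y: "y = f x" by blast
    from x have xC: "x \<in> carrier ?C" by (auto simp: T_def)
    from x have "x \<otimes>\<^bsub>?C\<^esub> x = Inl \<one>" by (auto simp: T_def)
    then have "y \<otimes>\<^bsub>?D\<^esub> y = Inl \<one>"
      using hom_mult[OF hom xC xC] f1 y by simp
    moreover have "y \<in> carrier ?D" using hom_in_carrier[OF hom xC] y by simp
    ultimately show "y \<in> T <+> T" by (auto simp: T_def)
  qed
  moreover have "inj_on f (T <+> carrier G)"
    using bij by (rule inj_on_subset[OF bij_betw_imp_inj_on]) (auto simp: T_def)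
  ultimately have "card (T <+> carrier G) \<le> card (T <+> T)"
    using T by (intro card_inj_on_le) auto
  then show False using T fin by (simp add: card_Plus)
qed

end

theorem theorem5p2:
  fixes G :: "('a, 'm) monoid_scheme"
    and \<alpha> \<beta> \<gamma> \<delta> :: "'a \<Rightarrow> 'a \<Rightarrow> 'a"
    and M Ma Mb Mc Md :: "('a + 'a) monoid"
  assumes "comm_group G" and "finite (carrier G)" and "order G > 1"
    and "\<not> elementary_abelian_2_group G"
    and "\<alpha> = theta G W_xy"
    and "\<beta> \<in> {theta G W_xy, theta G W_Xy}"
    and "\<gamma> = theta G W_xy"
    and "\<delta> \<in> {theta G W_xy, theta G W_Xy, theta G W_xY, theta G W_XY}"
    and "M = doubling G \<alpha> \<beta> \<gamma> \<delta>"
    and "Ma = doubling G (theta G W_xy) (theta G W_xy) (theta G W_xy) (theta G W_xy)"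
    and "Mb = doubling G (theta G W_xy) (theta G W_Xy) (theta G W_xy) (theta G W_Xy)"
    and "Mc = doubling G (theta G W_xy) (theta G W_xy) (theta G W_xy) (theta G W_Xy)"
    and "Md = doubling G (theta G W_xy) (theta G W_Xy) (theta G W_xy) (theta G W_xy)"
  shows "((group M \<longleftrightarrow> M = Ma \<or> M = Mb) \<and>
          Ma \<cong> G \<times>\<times> integer_mod_group 2 \<and>
          Mb \<cong> chein_loop G) \<and>
         ((left_bol_loop M \<and> \<not> associative M \<longleftrightarrow> left_bol_loop M \<and> \<not> moufang_loop M) \<and>
          (left_bol_loop M \<and> \<not> moufang_loop M \<longleftrightarrow>
             (\<forall>g\<in>carrier G. g [^]\<^bsub>G\<^esub> (4::nat) = \<one>\<^bsub>G\<^esub>) \<and> (M = Mc \<or> M = Md))) \<and>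
         \<not> Mc \<cong> Md"
proof -
  interpret comm_group G by fact
  have "\<exists>g\<in>carrier G. g [^]\<^bsub>G\<^esub> (2::nat) \<noteq> \<one>\<^bsub>G\<^esub>"
    using assms(1,4) by (simp add: elementary_abelian_2_group_def)
  then obtain g where g: "g \<in> carrier G" "g \<otimes>\<^bsub>G\<^esub> g \<noteq> \<one>\<^bsub>G\<^esub>"
    by (auto simp: numeral_2_eq_2)
  note defs = assms(10-13)
  have loop: "loop Ma" "loop Mb" "loop Mc" "loop Md"
    unfolding defs by (simp_all add: loop_word_doubling)
  have grp: "group Ma" "group Mb"
    unfolding defs by (simp_all add: group_word_doubling)
  then have mouf: "moufang_loop Ma" "moufang_loop Mb"
    using loop by (simp_all add: group_imp_associative associative_imp_moufang)
  have nmouf: "\<not> moufang_loop Mc" "\<not> moufang_loop Md"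
    unfolding defs using not_moufang_xy_xy_xy_Xy[OF g] not_moufang_xy_Xy_xy_xy[OF g] by auto
  then have nassoc: "\<not> associative Mc" "\<not> associative Md"
    using loop associative_imp_moufang by blast+
  have bol: "left_bol_loop Mc \<longleftrightarrow> (\<forall>g\<in>carrier G. g [^]\<^bsub>G\<^esub> (4::nat) = \<one>\<^bsub>G\<^esub>)"
    "left_bol_loop Md \<longleftrightarrow> (\<forall>g\<in>carrier G. g [^]\<^bsub>G\<^esub> (4::nat) = \<one>\<^bsub>G\<^esub>)"
    unfolding defs by (rule left_bol_xy_xy_xy_Xy_iff left_bol_xy_Xy_xy_xy_iff)+
  \<comment> \<open>Four of the eight choices of \<open>\<beta>\<close> and \<open>\<delta>\<close>
    give (a) to (d). The other four violate the left Bol law, hence are not groups either.\<close>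
  have M: "M = Ma \<or> M = Mb \<or> M = Mc \<or> M = Md \<or> (loop M \<and> \<not> left_bol_loop M)"
    using assms(5-9) not_left_bol_word_doubling[OF g] unfolding defs by (auto simp: loop_word_doubling)
  have iso: "Ma \<cong> G \<times>\<times> integer_mod_group 2" "Mb \<cong> chein_loop G" "\<not> Mc \<cong> Md"
    unfolding defs
    using xy_xy_xy_xy_iso_DirProd xy_Xy_xy_Xy_iso_chein_loop xy_xy_xy_Xy_not_iso_xy_Xy_xy_xy assms(2) g
    by auto
  have "group M \<longleftrightarrow> M = Ma \<or> M = Mb"
    using M grp nassoc associative_imp_left_bol group_imp_associative by blast
  \<comment> \<open>Associativity and the Moufang law both hold in (a) and (b) and both fail in (c)
    and (d), so they agree on all left Bol cases.\<close>
  moreover have "left_bol_loop M \<and> \<not> associative M \<longleftrightarrow> left_bol_loop M \<and> \<not> moufang_loop M"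
    using M grp mouf nmouf nassoc group_imp_associative by blast
  moreover have "left_bol_loop M \<and> \<not> moufang_loop M \<longleftrightarrow>
      (\<forall>g\<in>carrier G. g [^]\<^bsub>G\<^esub> (4::nat) = \<one>\<^bsub>G\<^esub>) \<and> (M = Mc \<or> M = Md)"
    using M mouf nmouf bol by blast
  ultimately show ?thesis using iso by blast
qed

end
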